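(* Let $n_i$ be a CA3 number, let $p$ be the smallest prime greater than $P(n_i)$, and let $n_j$ be the CA number constructed from the critical parameter $\epsilon_j=F(p,1)$. Let $t_0$ be the point at which $g(t)=t^{\epsilon_j}/\log\log t$ attains its unique minimum on $(e,\infty)$. Then $$G(n_j)>G(n_i)\left(1+\frac{3.2961}{(\log t_0)^2\log\log t_0}\right).$$
   Context: For an integer $n\ge 1$ let $\sigma(n)=\sum_{d\mid n}d$ and $\rho(n)=\sigma(n)/n$; for $n\ge 2$ let $G(n)=\rho(n)/\log\log n$. For real $x>1$ and integer $k\ge1$ let $F(x,k)=\dfrac{\log\left(1+\frac{1}{x+x^2+\cdots+x^k}\right)}{\log x}$. Let $E=\{F(p,k): p\text{ prime},\ k\ge 1\text{ integer}\}$, indexed in decreasing order $\epsilon_1>\epsilon_2>\cdots$. For $\epsilon\in E$ and each integer $k\ge1$ let $x_k$ be the unique real $x>1$ with $F(x,k)=\epsilon$. For each prime $p$ put $a_p=k$ if $x_{k+1}<p\le x_k$, and $a_p=0$ if $p>x_1$; $\prod_p p^{a_p}$ is the CA (colossally abundant) number constructed from $\epsilon$. Let $n_i$ be the CA number constructed from $\epsilon_i$ ($n_1<n_2<\cdots$). $P(n)$ denotes the largest prime factor of $n\ge2$. With $p$ the smallest prime greater than $P(n_i)$, $n_i$ is a CA3 number if $p<\log n_i$. *)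

theory Defs
  imports Complex_Main "HOL-Computational_Algebra.Primes"
begin

definition sigma :: "nat \<Rightarrow> nat" where
  "sigma n = (\<Sum>d | d dvd n. d)"

definition rho :: "nat \<Rightarrow> real" where
  "rho n = real (sigma n) / real n"

definition G :: "nat \<Rightarrow> real" where
  "G n = rho n / ln (ln (real n))"

definition F :: "real \<Rightarrow> nat \<Rightarrow> real" where
  "F x k = ln (1 + 1 / (\<Sum>i = 1..k. x ^ i)) / ln x"

definition E :: "real set" where
  "E = {F (real p) k | p k. prime p \<and> 1 \<le> k}"

text \<open>The decreasing enumeration of \<^term>\<open>E\<close>, starting at index 1: \<open>eps i\<close> is the element
  for which exactly \<open>i\<close> elements of \<^term>\<open>E\<close> (itself included) are at least as large. As
  \<open>card\<close> of an infinite set is 0, the condition entails finiteness for \<open>i \<ge> 1\<close>; the value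
  \<open>eps 0\<close> is unspecified.\<close>

definition eps :: "nat \<Rightarrow> real" where
  "eps i = (THE e. e \<in> E \<and> card {e' \<in> E. e \<le> e'} = i)"

definition xk :: "real \<Rightarrow> nat \<Rightarrow> real" where
  "xk e k = (THE x. 1 < x \<and> F x k = e)"

definition ca_exponent :: "real \<Rightarrow> nat \<Rightarrow> nat" where
  "ca_exponent e p =
     (if xk e 1 < real p then 0
      else (THE k. 1 \<le> k \<and> xk e (k + 1) < real p \<and> real p \<le> xk e k))"

text \<open>The product over all primes, restricted to the (finite) support of the exponents since
  \<open>prod\<close> over an infinite index set is 1.\<close>

definition ca_number :: "real \<Rightarrow> nat" where
  "ca_number e = (\<Prod>p | prime p \<and> ca_exponent e p \<noteq> 0. p ^ ca_exponent e p)"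

definition CA :: "nat \<Rightarrow> nat" where
  "CA i = ca_number (eps i)"

definition P :: "nat \<Rightarrow> nat" where
  "P n = Max (prime_factors n)"

definition next_prime :: "nat \<Rightarrow> nat" where
  "next_prime m = (LEAST p. prime p \<and> m < p)"

definition CA3 :: "nat \<Rightarrow> bool" where
  "CA3 n \<longleftrightarrow> (\<exists>i\<ge>1. n = CA i) \<and> real (next_prime (P n)) < ln (real n)"

definition min_point :: "real \<Rightarrow> real" where
  "min_point e = (THE t. is_arg_min (\<lambda>t. t powr e / ln (ln t)) (\<lambda>t. exp 1 < t) t)"

end

(*
  Since q powr F q k = rho (q ^ k) / rho (q ^ (k - 1)), the number n_j maximises rho n / n powr e
  for e = F p 1, which gives rho n_j / rho n_i >= (n_j / n_i) powr e.  With L = ln n and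
  h s = e * s - ln (ln s), this says ln (G n_j) - ln (G n_i) >= h L_j - h L_i.  Here L_i > p by the
  CA3 condition, and L_j >= L_i + ln p because p * n_i <= n_j.  As h is convex and increasing
  beyond p + ln p, the difference is at least h (p + ln p) - h p, i.e. the worst case is L_i = p.
  The minimum of g is at ln t0 = x with x * ln x = 1 / e, and x > p, so it remains to prove
    (1 + 1 / p) * ln p / ln (p + ln p) > 1 + 3.2961 / (p^2 * ln p).
  The left side is about 1 + (ln p)^2 / (2 * p^2 * ln p), so the inequality fails at p = 13 but
  holds from p = 17 on; for p <= 13 the exponents of n_i are so small that ln n_i < p.
*)
theory Submission
  imports Defs "HOL-Analysis.Harmonic_Numbers"
begin

section \<open>Real inequalities\<close>

text \<open>The difference of the two sides vanishes at 0 and has derivative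
  \<open>x ^ 3 / (1 + x)\<close>. The quadratic term is the source of the gain in the theorem; the
  cubic term bounds the error.\<close>

lemma ln_add_one_le_cubic:
  fixes u :: real
  assumes "0 \<le> u"
  shows "ln (1 + u) \<le> u - u\<^sup>2 / 2 + u ^ 3 / 3"
proof -
  let ?f = "\<lambda>u::real. u - u\<^sup>2 / 2 + u ^ 3 / 3 - ln (1 + u)"
  have "?f 0 \<le> ?f u"
  proof (rule DERIV_nonneg_imp_nondecreasing[OF assms])
    fix x :: real
    assume "0 \<le> x" "x \<le> u"
    then have "(?f has_real_derivative x ^ 3 / (1 + x)) (at x)"
      by (auto intro!: derivative_eq_intros simp: field_simps power2_eq_square power3_eq_cube)
    with \<open>0 \<le> x\<close> show "\<exists>y. (?f has_real_derivative y) (at x) \<and> 0 \<le> y"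
      by (intro exI[of _ "x ^ 3 / (1 + x)"]) auto
  qed
  then show ?thesis by simp
qed

text \<open>Obtained from 17 = 2^4 * (17 / 16). \<open>ln_shift_ratio_bound\<close> tolerates little
  loss in the lower bound, which enters it squared.\<close>

lemma ln_17_bounds: "2.82 \<le> ln (17::real)" "ln (17::real) \<le> 2.9"
proof -
  have "ln (17::real) = ln (2 ^ 4) + ln (17 / 16)"
    by (subst ln_mult_pos[symmetric]) auto
  also have "\<dots> = 4 * ln 2 + ln (17 / 16)"
    by (subst ln_realpow) auto
  finally have eq: "ln (17::real) = 4 * ln 2 + ln (17 / 16)" .
  have "ln (2::real) \<in> {0.691..25/36}"
    using ln_approx_bounds[of 2 2] ln2_le_25_over_36
    by (simp add: eval_nat_numeral)
  moreover have "ln (17 / 16 :: real) \<le> 1 / 16"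
    using ln_le_minus_one[of "17 / 16"] by simp
  moreover have "ln (16 / 17 :: real) \<le> - 1 / 17"
    using ln_le_minus_one[of "16 / 17"] by simp
  then have "1 / 17 \<le> ln (17 / 16 :: real)"
    using ln_inverse[of "17 / 16 :: real"] by simp
  ultimately show "2.82 \<le> ln (17::real)" "ln (17::real) \<le> 2.9"
    unfolding eq by auto
qed

text \<open>Since \<open>ln x\<close> is at least 1,
  \<open>ln (y / x) <= y / x - 1 <= ln x * (y / x - 1)\<close>, which rearranges to the
  claim.\<close>

lemma ln_over_self_le:
  fixes x y :: real
  assumes "exp 1 \<le> x" "x \<le> y"
  shows "ln y / y \<le> ln x / x"
proof -
  have x: "0 < x" "1 \<le> ln x"
    using assms(1) by (auto simp: ln_ge_iff less_le_trans[OF exp_gt_zero])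
  have "ln y - ln x = ln (y / x)"
    using x assms by (simp add: ln_div)
  also have "\<dots> \<le> y / x - 1"
    using x assms by (intro ln_le_minus_one) auto
  also have "\<dots> \<le> ln x * (y / x - 1)"
    using x assms mult_right_mono[of 1 "ln x" "y / x - 1"] by simp
  finally show ?thesis
    using x assms by (simp add: field_simps)
qed

text \<open>The worst case \<open>L = p\<close> of the theorem. The cubic estimate of
  \<open>ln (1 + c / p)\<close> reduces it to
  \<open>3.2961 * D < c * c * (1 / 2 - c / p / 3)\<close>. As \<open>p\<close> grows,
  \<open>c\<close> increases and \<open>c / p\<close> decreases, so the bounds at 17 serve for all
  larger \<open>p\<close>.\<close>

lemma ln_shift_ratio_bound:
  fixes p :: real
  assumes p: "17 \<le> p"
  shows "(1 + 3.2961 / (p\<^sup>2 * ln p)) * (ln (p + ln p) / ln p) < 1 + 1 / p"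
proof -
  define c where "c = ln p"
  define D where "D = 1 + 1 / p - c / (2 * p\<^sup>2) + c\<^sup>2 / (3 * p ^ 3)"
  have "ln 17 \<le> c" unfolding c_def using p by simp
  then have c: "2.82 \<le> c" using ln_17_bounds(1) by linarith
  have "exp 1 \<le> (17::real)" using exp_le by linarith
  then have "c / p \<le> ln 17 / 17"
    unfolding c_def using p by (rule ln_over_self_le)
  then have cp: "c / p \<le> 0.1706" using ln_17_bounds(2) by simp
  have "p + c = p * (1 + c / p)" using p by (simp add: field_simps)
  then have "ln (p + c) = c + ln (1 + c / p)"
    using p c ln_mult_pos[of p "1 + c / p"] by (simp add: c_def add_pos_pos)
  also have "ln (1 + c / p) \<le> c / p - (c / p)\<^sup>2 / 2 + (c / p) ^ 3 / 3"
    by (rule ln_add_one_le_cubic) (use p c in auto)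
  finally have "ln (p + c) / c \<le> (c + (c / p - (c / p)\<^sup>2 / 2 + (c / p) ^ 3 / 3)) / c"
    using c by (intro divide_right_mono) auto
  also have "\<dots> = D"
    unfolding D_def using p c by (simp add: field_simps power2_eq_square power3_eq_cube)
  finally have lnD: "ln (p + c) / c \<le> D" .
  have D': "D = 1 + 1 / p - c * (1 / 2 - c / p / 3) / p\<^sup>2"
    unfolding D_def using p by (simp add: field_simps power2_eq_square power3_eq_cube)
  \<comment> \<open>0.4431 lies just below 1/2 - 0.1706/3.\<close>
  have half: "0.4431 \<le> 1 / 2 - c / p / 3" using cp by simp
  have "D \<le> 1 + 1 / p"
    using half c divide_nonneg_nonneg[OF mult_nonneg_nonneg[of c "1 / 2 - c / p / 3"], of "p\<^sup>2"]
    unfolding D' by auto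
  also have "1 / p \<le> 1 / 17" using p by (simp add: field_simps)
  finally have D: "D \<le> 18 / 17" by simp
  \<comment> \<open>The size of the constant 3.2961 matters only here: the two sides are about 3.490
    and 3.524.\<close>
  have "3.2961 * D \<le> 3.2961 * (18 / 17)" using D by simp
  also have "\<dots> < 2.82 * 2.82 * 0.4431" by simp
  also have "\<dots> \<le> c * c * (1 / 2 - c / p / 3)"
    using c half by (intro mult_mono) auto
  finally have "3.2961 * D / (p\<^sup>2 * c) < c * c * (1 / 2 - c / p / 3) / (p\<^sup>2 * c)"
    using c p by (intro divide_strict_right_mono) auto
  also have "\<dots> = 1 + 1 / p - D"
    unfolding D' using c p by simp
  finally have "(1 + 3.2961 / (p\<^sup>2 * c)) * D < 1 + 1 / p"
    by (simp add: algebra_simps)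
  moreover have "(1 + 3.2961 / (p\<^sup>2 * c)) * (ln (p + c) / c) \<le> (1 + 3.2961 / (p\<^sup>2 * c)) * D"
    using lnD c by (intro mult_left_mono) auto
  ultimately show ?thesis unfolding c_def by linarith
qed

text \<open>The ratio is \<open>1 + ln (1 + c / z) / ln z\<close>, whose numerator falls and whose
  denominator grows with \<open>z\<close>. With \<open>c = ln p\<close> this replaces
  \<open>L\<close> by the worst case \<open>p\<close>.\<close>

lemma ln_shift_ratio_antimono:
  fixes c x y :: real
  assumes "1 < x" "x \<le> y" "0 \<le> c"
  shows "ln (y + c) / ln y \<le> ln (x + c) / ln x"
proof -
  have split: "ln (z + c) / ln z = 1 + ln (1 + c / z) / ln z" if "1 < z" for z
  proof -
    have "z + c = z * (1 + c / z)" using that by (simp add: field_simps)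
    moreover have "0 < 1 + c / z" using that assms(3) by (simp add: add_pos_nonneg)
    ultimately have "ln (z + c) = ln z + ln (1 + c / z)"
      using that by (simp add: ln_mult)
    then show ?thesis using that by (simp add: field_simps)
  qed
  have "1 + c / y \<le> 1 + c / x"
    using assms by (simp add: frac_le)
  then have "ln (1 + c / y) \<le> ln (1 + c / x)"
    using assms by (intro ln_mono) (auto simp: add_pos_nonneg)
  then have "ln (1 + c / y) / ln y \<le> ln (1 + c / x) / ln x"
    using assms by (intro frac_le) auto
  then show ?thesis using assms by (simp add: split)
qed

text \<open>The right-hand side is the tangent of \<open>ln \<circ> ln\<close> at \<open>x\<close>.\<close>

lemma ln_ln_less_tangent:
  fixes x y :: real
  assumes "1 < x" "1 < y" "x \<noteq> y"
  shows "ln (ln y) - ln (ln x) < (y - x) / (x * ln x)"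
proof -
  have "ln (ln y) - ln (ln x) = ln (ln y / ln x)"
    using assms by (simp add: ln_div)
  also have "\<dots> \<le> ln y / ln x - 1"
    using assms by (intro ln_le_minus_one) auto
  also have "\<dots> = ln (y / x) / ln x"
    using assms by (simp add: ln_div field_simps)
  also have "ln (y / x) < y / x - 1"
    \<comment> \<open>Strictness comes from this second use of \<open>ln u <= u - 1\<close>, at
      \<open>u = y / x\<close>, which differs from 1.\<close>
    using assms ln_eq_minus_one[of "y / x"] ln_le_minus_one[of "y / x"] by fastforce
  finally show ?thesis
    using assms by (simp add: field_simps)
qed

section \<open>The minimum of \<open>t powr e / ln (ln t)\<close>\<close>

lemma ex_mult_ln_eq:
  fixes a :: real
  assumes "0 < a"
  shows "\<exists>x>1. x * ln x = a"
proof -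
  \<comment> \<open>Right end for the intermediate value theorem: the logarithm there is at least 1,
    so the product is at least \<open>a\<close>.\<close>
  have "0 < exp 1 + a" using assms by (simp add: add_pos_pos)
  then have "1 \<le> ln (exp 1 + a)" using assms by (simp add: ln_ge_iff)
  then have "a \<le> (exp 1 + a) * ln (exp 1 + a)"
    using assms mult_mono[of a "exp 1 + a" 1 "ln (exp 1 + a)"] by simp
  moreover have "continuous_on {1..exp 1 + a} (\<lambda>x::real. x * ln x)"
    by (intro continuous_intros) auto
  moreover have "1 \<le> exp 1 + a" using assms exp_ge_add_one_self[of 1] by linarith
  ultimately obtain x where x: "1 \<le> x" "x * ln x = a"
    using IVT'[of "\<lambda>x. x * ln x" 1 a "exp 1 + a"] assms by auto
  with assms have "x \<noteq> 1" by auto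
  with x(1) have "1 < x" by simp
  with x(2) show ?thesis by blast
qed

text \<open>With \<open>s = ln t\<close> the logarithm of the function is
  \<open>e * s - ln (ln s)\<close>. Its slope vanishes at \<open>x\<close>, and the tangent
  inequality for \<open>ln (ln s)\<close> makes \<open>x\<close> a strict global minimum, which
  gives both existence and uniqueness for \<open>THE\<close>.\<close>

lemma min_point_eq:
  fixes e x :: real
  assumes x: "1 < x" "x * ln x = 1 / e"
  shows "min_point e = exp x"
proof -
  let ?g = "\<lambda>t::real. t powr e / ln (ln t)"
  have g_eq: "?g t = exp (e * ln t - ln (ln (ln t)))" if "exp 1 < t" for t
  proof -
    have "0 < t" using that exp_gt_zero[of "1::real"] by linarith
    moreover from this have "1 < ln t" using that by (metis exp_less_cancel_iff exp_ln)
    moreover from this have "0 < ln (ln t)" by simp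
    ultimately show ?thesis by (simp add: exp_diff powr_def)
  qed
  have less: "?g (exp x) < ?g t" if t: "exp 1 < t" "t \<noteq> exp x" for t
  proof -
    have pos: "0 < t" using t(1) exp_gt_zero[of "1::real"] by linarith
    have L: "1 < ln t" "ln t \<noteq> x"
      using t pos by (metis exp_less_cancel_iff exp_ln, metis exp_ln)
    then have "ln (ln (ln t)) - ln (ln x) < (ln t - x) / (x * ln x)"
      using x(1) by (intro ln_ln_less_tangent) auto
    then have "e * x - ln (ln x) < e * ln t - ln (ln (ln t))"
      unfolding x(2) by (simp add: algebra_simps)
    then show ?thesis
      unfolding g_eq[OF t(1)] using g_eq[of "exp x"] x(1) by simp
  qed
  have "is_arg_min ?g (\<lambda>t. exp 1 < t) (exp x)"
    unfolding is_arg_min_linorder using x(1) less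
    by (metis exp_less_cancel_iff order.order_iff_strict)
  moreover have "t = exp x" if "is_arg_min ?g (\<lambda>t. exp 1 < t) t" for t
    using that less x(1) unfolding is_arg_min_def by (metis exp_less_cancel_iff)
  ultimately show ?thesis
    unfolding min_point_def by (rule the_equality)
qed

section \<open>The functions sigma and rho\<close>

text \<open>A divisor of \<open>a * b\<close> splits uniquely into a divisor of \<open>a\<close> and
  one of \<open>b\<close>, so the product of the two sums meets every divisor once.\<close>

lemma sigma_mult_coprime:
  assumes "coprime a b"
  shows "sigma (a * b) = sigma a * sigma b"
proof -
  let ?A = "{d. d dvd a}" and ?B = "{d. d dvd b}"
  have inj: "inj_on (\<lambda>(x, y). x * y) (?A \<times> ?B)"
  proof (rule inj_onI, clarsimp)
    fix x y x' y'
    assume d: "x dvd a" "y dvd b" "x' dvd a" "y' dvd b" and eq: "x * y = x' * y'"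
    from assms d have "coprime x y'" "coprime x' y" "coprime y x'" "coprime y' x"
      by (metis coprime_commute coprime_divisors)+
    with eq show "x = x' \<and> y = y'"
      by (metis coprime_crossproduct_nat mult.commute)
  qed
  have img: "(\<lambda>(x, y). x * y) ` (?A \<times> ?B) = {d. d dvd a * b}"
  proof
    show "(\<lambda>(x, y). x * y) ` (?A \<times> ?B) \<subseteq> {d. d dvd a * b}"
      by (auto intro: mult_dvd_mono)
    show "{d. d dvd a * b} \<subseteq> (\<lambda>(x, y). x * y) ` (?A \<times> ?B)"
    proof
      fix d assume "d \<in> {d. d dvd a * b}"
      then obtain x y where "d = x * y" "x dvd a" "y dvd b"
        using division_decomp by blast
      then show "d \<in> (\<lambda>(x, y). x * y) ` (?A \<times> ?B)" by force
    qed
  qed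
  have "sigma (a * b) = (\<Sum>(x, y)\<in>?A \<times> ?B. x * y)"
    unfolding sigma_def img[symmetric] by (subst sum.reindex[OF inj]) (simp add: case_prod_unfold)
  also have "\<dots> = sigma a * sigma b"
    unfolding sigma_def by (simp add: sum_product sum.cartesian_product)
  finally show ?thesis .
qed

lemma sigma_prime_power:
  assumes "prime p"
  shows "sigma (p ^ k) = (\<Sum>i\<le>k. p ^ i)"
proof -
  have "{d. d dvd p ^ k} = (\<lambda>i. p ^ i) ` {..k}"
    using assms by (auto simp: divides_primepow_nat)
  moreover have "inj_on (\<lambda>i. p ^ i) {..k}"
    using prime_gt_1_nat[OF assms] by (auto intro!: inj_onI)
  ultimately show ?thesis
    unfolding sigma_def by (simp add: sum.reindex)
qed

lemma rho_mult_coprime: "coprime a b \<Longrightarrow> rho (a * b) = rho a * rho b"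
  by (simp add: rho_def sigma_mult_coprime)

lemma rho_prod_prime_powers:
  assumes "finite A" "\<And>q. q \<in> A \<Longrightarrow> prime q"
  shows "rho (\<Prod>q\<in>A. q ^ f q) = (\<Prod>q\<in>A. rho (q ^ f q))"
  using assms
proof (induction A rule: finite_induct)
  case empty
  show ?case by (simp add: rho_def sigma_def)
next
  case (insert q A)
  have "coprime (q ^ f q) (\<Prod>r\<in>A. r ^ f r)"
    using insert by (intro prod_coprime_right coprime_power_left_iff[THEN iffD2] disjI1)
      (metis coprime_power_left_iff coprime_power_right_iff insertCI primes_coprime)
  with insert show ?case by (simp add: rho_mult_coprime)
qed

section \<open>The function F\<close>

lemma sum_powers_pos:
  fixes x :: real
  assumes "0 < x" "1 \<le> k"
  shows "0 < (\<Sum>i = 1..k. x ^ i)"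
  using assms by (intro sum_pos) auto

lemma F_pos: "1 < x \<Longrightarrow> 1 \<le> k \<Longrightarrow> 0 < F x k"
  unfolding F_def using sum_powers_pos[of x k]
  by (intro divide_pos_pos ln_gt_zero) auto

lemma F_strict_antimono_left:
  assumes "1 < x" "x < y" "1 \<le> k"
  shows "F y k < F x k"
proof -
  have "(\<Sum>i = 1..k. x ^ i) < (\<Sum>i = 1..k. y ^ i)"
    using assms by (intro sum_strict_mono) (auto intro!: power_strict_mono)
  moreover have "0 < (\<Sum>i = 1..k. x ^ i)"
    using assms by (intro sum_powers_pos) auto
  ultimately have "ln (1 + 1 / (\<Sum>i = 1..k. y ^ i)) < ln (1 + 1 / (\<Sum>i = 1..k. x ^ i))"
    by (simp add: add_pos_pos frac_less2)
  moreover have "0 \<le> ln (1 + 1 / (\<Sum>i = 1..k. y ^ i))"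
    using sum_powers_pos[of y k] assms by (intro ln_ge_zero) simp
  ultimately show ?thesis
    unfolding F_def using assms by (intro frac_less) auto
qed

lemma F_antimono_left:
  "1 < x \<Longrightarrow> x \<le> y \<Longrightarrow> 1 \<le> k \<Longrightarrow> F y k \<le> F x k"
  using F_strict_antimono_left[of x y k] by (cases "x = y") auto

lemma F_antimono_right:
  assumes "1 < x" "1 \<le> k" "k \<le> l"
  shows "F x l \<le> F x k"
proof -
  have "(\<Sum>i = 1..k. x ^ i) \<le> (\<Sum>i = 1..l. x ^ i)"
    using assms by (intro sum_mono2) auto
  moreover have "0 < (\<Sum>i = 1..k. x ^ i)"
    using assms by (intro sum_powers_pos) auto
  ultimately have "ln (1 + 1 / (\<Sum>i = 1..l. x ^ i)) \<le> ln (1 + 1 / (\<Sum>i = 1..k. x ^ i))"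
    by (simp add: add_pos_pos frac_le)
  then show ?thesis
    unfolding F_def using assms by (intro divide_right_mono) auto
qed

text \<open>A crude bound, good enough to show that only finitely many pairs of a prime and a level
  have \<open>F\<close> above a given positive value.\<close>

lemma F_less_inverse:
  assumes "2 \<le> x" "1 \<le> k"
  shows "F x k < 2 / (k * x)"
proof -
  have "k * x = (\<Sum>i = 1..k. x)" by simp
  also have "\<dots> \<le> (\<Sum>i = 1..k. x ^ i)"
    using assms by (intro sum_mono) (auto intro: self_le_power)
  finally have S: "k * x \<le> (\<Sum>i = 1..k. x ^ i)" .
  have kx: "0 < k * x" using assms by simp
  have "ln (1 + 1 / (\<Sum>i = 1..k. x ^ i)) \<le> 1 / (\<Sum>i = 1..k. x ^ i)"
    using S kx by (intro ln_add_one_self_le_self) auto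
  also have "\<dots> \<le> 1 / (k * x)"
    using S kx by (intro divide_left_mono) auto
  finally have num: "ln (1 + 1 / (\<Sum>i = 1..k. x ^ i)) \<le> 1 / (k * x)" .
  have "ln 2 \<le> ln x" using assms by simp
  then have "1 / 2 < ln x" using ln2_ge_two_thirds by linarith
  have "F x k \<le> 1 / (k * x) / ln x"
    unfolding F_def using num \<open>1 / 2 < ln x\<close> by (intro divide_right_mono) auto
  also have "\<dots> < 1 / (k * x) / (1 / 2)"
    using kx \<open>1 / 2 < ln x\<close> by (intro divide_strict_left_mono) auto
  finally show ?thesis by simp
qed

lemma ex_F_eq:
  assumes "0 < e" "1 \<le> k"
  shows "\<exists>x>1. F x k = e"
proof -
  \<comment> \<open>\<open>c\<close> is the numerator of \<open>F\<close> at 2. Left of 2 the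
    numerator is at least \<open>c\<close>, so \<open>ln a <= c / e\<close> forces
    \<open>F a k >= e\<close>; at the other end \<open>F b k < 2 / b <= e\<close>.\<close>
  define c where "c = ln (1 + 1 / (\<Sum>i = 1..k. 2 ^ i :: real))"
  define a where "a = min 2 (exp (c / e))"
  define b where "b = max 2 (2 / e)"
  have "0 < c" unfolding c_def using sum_powers_pos[of 2 k] assms
    by (intro ln_gt_zero) simp
  then have a: "1 < a" "a \<le> 2" "ln a \<le> c / e"
    unfolding a_def using assms by (auto simp: min_def ln_ge_iff)
      (metis exp_gt_zero ln_exp ln_le_cancel_iff zero_less_numeral)
  have b: "2 \<le> b" "2 / e \<le> b" unfolding b_def by auto
  have "(\<Sum>i = 1..k. a ^ i) \<le> (\<Sum>i = 1..k. 2 ^ i)"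
    using a by (intro sum_mono power_mono) auto
  moreover have "0 < (\<Sum>i = 1..k. a ^ i)"
    using a assms by (intro sum_powers_pos) auto
  ultimately have "c \<le> ln (1 + 1 / (\<Sum>i = 1..k. a ^ i))"
    unfolding c_def by (intro ln_mono) (auto simp: add_pos_pos frac_le sum_powers_pos)
  moreover have "e * ln a \<le> c" using a assms by (simp add: field_simps)
  ultimately have "e \<le> F a k"
    unfolding F_def using a by (simp add: field_simps)
  moreover have "F b k \<le> e"
  proof -
    have "F b k \<le> F b 1" using b assms by (intro F_antimono_right) auto
    also have "\<dots> < 2 / b" using F_less_inverse[of b 1] b by simp
    also have "\<dots> \<le> e" using b assms by (simp add: field_simps)
    finally show ?thesis by simp
  qed
  moreover have "continuous_on {a..b} (\<lambda>x. F x k)"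
    unfolding F_def
  proof (intro continuous_intros ballI)
    fix x assume "x \<in> {a..b}"
    then have "1 < x" using a by auto
    then have "0 < (\<Sum>i = 1..k. x ^ i)" using assms by (intro sum_powers_pos) auto
    then show "(\<Sum>i = 1..k. x ^ i) \<noteq> 0" "1 + 1 / (\<Sum>i = 1..k. x ^ i) \<noteq> 0"
      by (auto simp: add_pos_pos less_imp_neq[symmetric])
    show "x \<noteq> 0" "ln x \<noteq> 0" using \<open>1 < x\<close> by auto
  qed
  ultimately obtain x where "a \<le> x" "F x k = e"
    using IVT2'[of "\<lambda>x. F x k" b e a] a b by auto
  with a show ?thesis by (intro exI[of _ x]) auto
qed

section \<open>Colossally abundant numbers\<close>

lemma xk_props:
  assumes "0 < e" "1 \<le> k"
  shows "1 < xk e k" "F (xk e k) k = e"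
proof -
  have "\<exists>!x. 1 < x \<and> F x k = e"
    using ex_F_eq[OF assms] F_strict_antimono_left assms(2)
    by (metis less_irrefl linorder_neqE_linordered_idom)
  from theI'[OF this] show "1 < xk e k" "F (xk e k) k = e"
    unfolding xk_def by auto
qed

lemma le_xk_iff:
  assumes "0 < e" "1 \<le> k" "1 < y"
  shows "y \<le> xk e k \<longleftrightarrow> e \<le> F y k"
  using xk_props[OF assms(1,2)] F_antimono_left[of y "xk e k" k]
    F_strict_antimono_left[of "xk e k" y k] assms by fastforce

text \<open>Replaces the two nested \<open>THE\<close> operators by one inequality in
  \<open>F\<close>; all later facts about exponents rest on it. It holds because \<open>F\<close>
  decreases in \<open>x\<close>, so that \<open>p <= xk e l\<close> means \<open>e <= F p l\<close>,
  and is nonincreasing in the level.\<close>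

lemma le_ca_exponent_iff:
  assumes "0 < e" "prime p" "1 \<le> k"
  shows "k \<le> ca_exponent e p \<longleftrightarrow> e \<le> F p k"
proof -
  have p: "2 \<le> real p" using prime_ge_2_nat[OF assms(2)] by simp
  have iff: "real p \<le> xk e l \<longleftrightarrow> e \<le> F p l" if "1 \<le> l" for l
    using le_xk_iff[of e l p] assms that p by simp
  show ?thesis
  proof (cases "e \<le> F p 1")
    case False
    then have "\<not> e \<le> F p k"
      using F_antimono_right[of p 1 k] p assms(3) by auto
    moreover have "ca_exponent e p = 0"
      unfolding ca_exponent_def using iff[of 1] False by auto
    ultimately show ?thesis using assms(3) by auto
  next
    case True
    let ?Q = "\<lambda>l. 1 \<le> l \<and> F p (l + 1) < e \<and> e \<le> F p l"
    have "\<exists>n\<ge>1. F p n < e"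
    proof -
      obtain n where n: "1 \<le> n" "1 / e \<le> real n"
        using real_arch_simple[of "max 1 (1 / e)"] by auto
      have "F p n < 2 / (real n * p)" using p n by (intro F_less_inverse) auto
      also have "\<dots> \<le> 2 / (real n * 2)"
        using p n by (intro divide_left_mono mult_left_mono) auto
      also have "\<dots> \<le> e" using n assms(1) by (simp add: field_simps)
      finally show ?thesis using n(1) by blast
    qed
    \<comment> \<open>The first level at which \<open>F p\<close> drops below \<open>e\<close>; the
      exponent is the level before it. The case assumption excludes \<open>n = 1\<close>, so
      \<open>n - 1\<close> is a valid level.\<close>
    define n where "n = (LEAST n. 1 \<le> n \<and> F p n < e)"
    have n: "1 \<le> n" "F p n < e"
      using LeastI_ex[OF \<open>\<exists>n\<ge>1. F p n < e\<close>] unfolding n_def by auto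
    have "n \<noteq> 1" using n True by auto
    then have "?Q (n - 1)"
      using n not_less_Least[of "n - 1" "\<lambda>n. 1 \<le> n \<and> F p n < e"] unfolding n_def[symmetric]
      by auto
    \<comment> \<open>Any \<open>m\<close> with \<open>?Q m\<close> separates the levels with
      \<open>e <= F p l\<close> from the rest. This yields uniqueness for \<open>THE\<close> and
      then the claim itself.\<close>
    moreover have char: "l \<le> m \<longleftrightarrow> e \<le> F p l" if "?Q m" "1 \<le> l" for l m
      using that F_antimono_right[of p l m] F_antimono_right[of p "m + 1" l] p
      by (cases "l \<le> m") auto
    ultimately have "\<exists>!l. ?Q l"
      by (metis order.antisym order.refl)
    moreover have "ca_exponent e p = (THE l. ?Q l)"
    proof -
      have "(1 \<le> l \<and> xk e (l + 1) < p \<and> p \<le> xk e l) = ?Q l" for l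
        using iff[of l] iff[of "l + 1"] by auto
      moreover have "\<not> xk e 1 < p" using iff[of 1] True by auto
      ultimately show ?thesis unfolding ca_exponent_def by simp
    qed
    ultimately have "?Q (ca_exponent e p)" by (metis (no_types, lifting) theI')
    from char[OF this assms(3)] show ?thesis .
  qed
qed

text \<open>A nonzero exponent means \<open>e <= F p 1 < 2 / p\<close>. Finiteness ensures that the
  product defining the CA number does not collapse to the default 1.\<close>

lemma finite_ca_support:
  assumes "0 < e"
  shows "finite {p. prime p \<and> ca_exponent e p \<noteq> 0}"
proof (rule finite_subset)
  show "{p. prime p \<and> ca_exponent e p \<noteq> 0} \<subseteq> {..nat \<lceil>2 / e\<rceil>}"
  proof
    fix p assume p: "p \<in> {p. prime p \<and> ca_exponent e p \<noteq> 0}"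
    then have "2 \<le> p" by (auto intro: prime_ge_2_nat)
    from p have "e \<le> F p 1" using le_ca_exponent_iff[of e p 1] assms by auto
    also have "\<dots> < 2 / p" using F_less_inverse[of p 1] \<open>2 \<le> p\<close> by simp
    finally have "p < 2 / e" using \<open>2 \<le> p\<close> assms by (simp add: field_simps)
    then show "p \<in> {..nat \<lceil>2 / e\<rceil>}" by (simp add: le_nat_iff) linarith
  qed
qed simp

text \<open>The reason behind the formula for \<open>F\<close>: from
  \<open>sigma (q ^ Suc k) = 1 + q * sigma (q ^ k)\<close> the quotient of consecutive
  \<open>rho\<close> values is 1 plus the reciprocal of q + ... + q^(k+1), and \<open>F\<close> is
  its logarithm to base \<open>q\<close>.\<close>

lemma rho_prime_power_Suc:
  assumes "prime q"
  shows "rho (q ^ Suc k) = rho (q ^ k) * q powr F q (Suc k)"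
proof -
  let ?S = "\<lambda>k. \<Sum>i\<le>k. real q ^ i"
  have q: "1 < real q" using prime_gt_1_nat[OF assms] by simp
  have rho: "rho (q ^ k) = ?S k / q ^ k" for k
    unfolding rho_def sigma_prime_power[OF assms] by simp
  have shift: "(\<Sum>i = 1..Suc k. real q ^ i) = q * ?S k"
    unfolding sum_distrib_left using sum.shift_bounds_cl_Suc_ivl[of "\<lambda>i. real q ^ i" 0 k]
    by (simp add: atLeast0AtMost)
  have S: "?S (Suc k) = 1 + q * ?S k"
    using sum.atMost_Suc_shift[of "\<lambda>i. real q ^ i" k] by (simp add: sum_distrib_left)
  have "0 < ?S k" using q by (intro sum_pos) auto
  then have "q powr F q (Suc k) = 1 + 1 / (q * ?S k)"
    unfolding F_def shift powr_def using q by (simp add: add_pos_pos)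
  then have "?S (Suc k) = q * ?S k * q powr F q (Suc k)"
    unfolding S using \<open>0 < ?S k\<close> q by (simp add: field_simps)
  then show ?thesis
    unfolding rho using q by simp
qed

text \<open>Passing from exponent \<open>k - 1\<close> to \<open>k\<close> multiplies the local
  factor by \<open>q powr F q k / q powr e\<close>, which is at least 1 as long as
  \<open>e <= F q k\<close>.\<close>

lemma rho_prime_power_mono:
  assumes "prime q" "a \<le> b" "\<And>k. a < k \<Longrightarrow> k \<le> b \<Longrightarrow> e \<le> F q k"
  shows "rho (q ^ a) / real (q ^ a) powr e \<le> rho (q ^ b) / real (q ^ b) powr e"
  using assms(2,3)
proof (induction b rule: dec_induct)
  case (step b)
  have q: "1 < real q" using prime_gt_1_nat[OF assms(1)] by simp
  have "rho (q ^ a) / real (q ^ a) powr e \<le> rho (q ^ b) / real (q ^ b) powr e"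
    using step by auto
  also have "\<dots> \<le> rho (q ^ b) / real (q ^ b) powr e * (q powr F q (Suc b) / q powr e)"
  proof -
    have "q powr e \<le> q powr F q (Suc b)"
      using step q by (intro powr_mono) auto
    then have "1 \<le> q powr F q (Suc b) / q powr e" using q by simp
    then show ?thesis
      using mult_left_mono[of 1 "q powr F q (Suc b) / q powr e" "rho (q ^ b) / real (q ^ b) powr e"]
      by (simp add: rho_def)
  qed
  also have "\<dots> = rho (q ^ Suc b) / real (q ^ Suc b) powr e"
    unfolding rho_prime_power_Suc[OF assms(1)] by (simp add: powr_mult)
  finally show ?case .
qed simp

section \<open>Comparison of CA numbers with different parameters\<close>

lemma ca_exponent_antimono:
  assumes "0 < e" "e \<le> e'" "prime q"
  shows "ca_exponent e' q \<le> ca_exponent e q"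
proof (cases "ca_exponent e' q = 0")
  case False
  then have "1 \<le> ca_exponent e' q" by simp
  then show ?thesis
    using le_ca_exponent_iff[of e' q "ca_exponent e' q"] le_ca_exponent_iff[of e q "ca_exponent e' q"]
      assms by auto
qed simp

lemma ca_support_antimono:
  assumes "0 < e" "e \<le> e'"
  shows "{q. prime q \<and> ca_exponent e' q \<noteq> 0} \<subseteq> {q. prime q \<and> ca_exponent e q \<noteq> 0}"
proof
  fix q assume "q \<in> {q. prime q \<and> ca_exponent e' q \<noteq> 0}"
  with ca_exponent_antimono[OF assms, of q] show "q \<in> {q. prime q \<and> ca_exponent e q \<noteq> 0}"
    by auto
qed

text \<open>Additional primes contribute \<open>q ^ 0 = 1\<close>, so two CA numbers can be written
  over one common index set.\<close>

lemma ca_number_eq_prod: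
  assumes "finite A" "{q. prime q \<and> ca_exponent e q \<noteq> 0} \<subseteq> A" "\<And>q. q \<in> A \<Longrightarrow> prime q"
  shows "ca_number e = (\<Prod>q\<in>A. q ^ ca_exponent e q)"
  unfolding ca_number_def using assms by (intro prod.mono_neutral_left) auto

lemma ca_number_pos: "0 < ca_number e"
  unfolding ca_number_def by (intro prod_pos) (auto simp: prime_gt_0_nat)

lemma rho_pos:
  assumes "0 < n"
  shows "0 < rho n"
proof -
  have "1 \<le> sigma n"
    unfolding sigma_def using assms member_le_sum[of 1 "{d. d dvd n}" "\<lambda>d. d"] by simp
  with assms show ?thesis by (simp add: rho_def)
qed

text \<open>Both sides factor over the same primes. The smaller parameter has the larger exponents,
  so each local factor only moves upward, through levels \<open>k\<close> with
  \<open>e <= F q k\<close>.\<close>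

lemma rho_ca_number_mono:
  assumes "0 < e" "e \<le> e'"
  shows "rho (ca_number e') / real (ca_number e') powr e
           \<le> rho (ca_number e) / real (ca_number e) powr e"
proof -
  define A where "A = {q. prime q \<and> ca_exponent e q \<noteq> 0}"
  have fin: "finite A" and pr: "\<And>q. q \<in> A \<Longrightarrow> prime q"
    unfolding A_def using finite_ca_support[OF assms(1)] by auto
  have "{q. prime q \<and> ca_exponent e' q \<noteq> 0} \<subseteq> A"
    unfolding A_def by (rule ca_support_antimono[OF assms])
  from ca_number_eq_prod[OF fin this pr]
  have n': "ca_number e' = (\<Prod>q\<in>A. q ^ ca_exponent e' q)" .
  from ca_number_eq_prod[OF fin _ pr, of e]
  have n: "ca_number e = (\<Prod>q\<in>A. q ^ ca_exponent e q)" by (simp add: A_def)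
  have split: "rho (\<Prod>q\<in>A. q ^ f q) / real (\<Prod>q\<in>A. q ^ f q) powr e
      = (\<Prod>q\<in>A. rho (q ^ f q) / real (q ^ f q) powr e)" for f
    using rho_prod_prime_powers[OF fin pr] by (simp add: prod_powr_distrib prod_dividef)
  show ?thesis
    unfolding n n' split
  proof (intro prod_mono conjI)
    fix q assume "q \<in> A"
    then have q: "prime q" by (rule pr)
    show "0 \<le> rho (q ^ ca_exponent e' q) / real (q ^ ca_exponent e' q) powr e"
      by (simp add: rho_def)
    show "rho (q ^ ca_exponent e' q) / real (q ^ ca_exponent e' q) powr e
        \<le> rho (q ^ ca_exponent e q) / real (q ^ ca_exponent e q) powr e"
    proof (rule rho_prime_power_mono[OF q ca_exponent_antimono[OF assms q]])
      fix k assume "ca_exponent e' q < k" "k \<le> ca_exponent e q"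
      then show "e \<le> F q k"
        using le_ca_exponent_iff[OF assms(1) q, of k] by simp
    qed
  qed
qed

text \<open>No exponent drops from \<open>e'\<close> to \<open>e\<close>, and the one at
  \<open>p\<close> rises by at least 1, which pays for the extra factor \<open>p\<close>.\<close>

lemma mult_ca_number_le:
  assumes "0 < e" "e \<le> e'" "prime p" "ca_exponent e' p < ca_exponent e p"
  shows "p * ca_number e' \<le> ca_number e"
proof -
  define A where "A = {q. prime q \<and> ca_exponent e q \<noteq> 0}"
  have fin: "finite A" and pr: "\<And>q. q \<in> A \<Longrightarrow> prime q"
    unfolding A_def using finite_ca_support[OF assms(1)] by auto
  have "p \<in> A" unfolding A_def using assms by auto
  have le: "ca_exponent e' q \<le> ca_exponent e q" if "prime q" for q
    using ca_exponent_antimono[OF assms(1,2) that] .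
  have "{q. prime q \<and> ca_exponent e' q \<noteq> 0} \<subseteq> A"
    unfolding A_def by (rule ca_support_antimono[OF assms(1,2)])
  from ca_number_eq_prod[OF fin this pr]
  have "p * ca_number e' = p ^ Suc (ca_exponent e' p) * (\<Prod>q\<in>A - {p}. q ^ ca_exponent e' q)"
    by (simp add: prod.remove[OF fin \<open>p \<in> A\<close>])
  also have "\<dots> \<le> p ^ ca_exponent e p * (\<Prod>q\<in>A - {p}. q ^ ca_exponent e q)"
    using assms le pr
    by (intro mult_mono power_increasing prod_mono conjI) (auto simp: prime_gt_0_nat Suc_le_eq intro!: power_increasing)
  also have "\<dots> = (\<Prod>q\<in>A. q ^ ca_exponent e q)"
    by (simp add: prod.remove[OF fin \<open>p \<in> A\<close>])
  also have "\<dots> = ca_number e"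
    using ca_number_eq_prod[OF fin _ pr, of e] by (simp add: A_def)
  finally show ?thesis .
qed

section \<open>Prime factors and upper bounds of CA numbers\<close>

lemma prime_factors_ca_number:
  assumes "0 < e"
  shows "prime_factors (ca_number e) = {q. prime q \<and> ca_exponent e q \<noteq> 0}" (is "_ = ?A")
proof (intro equalityI subsetI)
  fix q assume "q \<in> ?A"
  show "q \<in> prime_factors (ca_number e)"
  proof -
    have "q dvd q ^ ca_exponent e q" using \<open>q \<in> ?A\<close> by (auto intro: dvd_power)
    also have "\<dots> dvd ca_number e"
      unfolding ca_number_def using finite_ca_support[OF assms] \<open>q \<in> ?A\<close> by (intro dvd_prodI) auto
    finally show ?thesis
      using \<open>q \<in> ?A\<close> ca_number_pos[of e] by (simp add: prime_factors_dvd)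
  qed
next
  fix q assume q: "q \<in> prime_factors (ca_number e)"
  then have "prime q" and q_dvd: "q dvd (\<Prod>r\<in>?A. r ^ ca_exponent e r)"
    by (auto simp: ca_number_def)
  from q_dvd have "\<exists>r\<in>?A. q dvd r ^ ca_exponent e r"
    by (rule prime_dvd_prod_iff[OF finite_ca_support[OF assms] \<open>prime q\<close>, THEN iffD1])
  then obtain r where r: "r \<in> ?A" "q dvd r ^ ca_exponent e r" by (rule bexE)
  from \<open>prime q\<close> r(2) have "q dvd r" by (rule prime_dvd_power)
  with r(1) \<open>prime q\<close> have "q = r" by (simp add: primes_dvd_imp_eq)
  with r(1) show "q \<in> ?A" by simp
qed

text \<open>The last two assumptions give \<open>F q (k + 1) \<le> F p 1\<close> on taking logarithms.\<close>

lemma ca_exponent_leI: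
  assumes "0 < e" "F p 1 < e" "prime p" "prime q" "p \<le> q ^ m"
    and "(1 + 1 / (\<Sum>i = 1..Suc k. real q ^ i)) ^ m \<le> 1 + 1 / real p"
  shows "ca_exponent e q \<le> k"
proof -
  have p: "1 < real p" and q: "1 < real q"
    using assms prime_gt_1_nat by auto
  let ?S = "\<Sum>i = 1..Suc k. real q ^ i"
  have S: "0 < ?S" using q by (intro sum_powers_pos) auto
  \<comment> \<open>The integer \<open>m\<close> bounds \<open>ln p / ln q\<close> from above, so
    that comparing two values of \<open>F\<close> becomes a test on rational numbers.\<close>
  have "ln (real p) \<le> ln (real q ^ m)"
    using p q assms(5) by (intro ln_mono) (simp_all flip: of_nat_power)
  then have 1: "ln p \<le> m * ln q" using q by (simp add: ln_realpow)
  have "ln ((1 + 1 / ?S) ^ m) \<le> ln (1 + 1 / p)"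
    using S assms(6) by (intro ln_mono) (auto simp: add_pos_pos simp del: sum.cl_ivl_Suc)
  then have 2: "m * ln (1 + 1 / ?S) \<le> ln (1 + 1 / p)"
    using S by (subst (asm) ln_realpow) (auto simp: add_pos_pos simp del: sum.cl_ivl_Suc)
  have "0 \<le> ln (1 + 1 / ?S)" using S by (intro ln_ge_zero) (simp del: sum.cl_ivl_Suc)
  then have "ln p * ln (1 + 1 / ?S) \<le> m * ln q * ln (1 + 1 / ?S)"
    using 1 by (rule mult_right_mono[rotated])
  also have "\<dots> = ln q * (m * ln (1 + 1 / ?S))" by simp
  also have "\<dots> \<le> ln q * ln (1 + 1 / p)" using 2 q by (intro mult_left_mono) auto
  finally have "F q (Suc k) \<le> F p 1"
    unfolding F_def using p q by (simp add: field_simps del: sum.cl_ivl_Suc)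
  with assms(2) have "\<not> e \<le> F q (Suc k)" by simp
  with le_ca_exponent_iff[OF assms(1,4), of "Suc k"] show ?thesis by simp
qed

lemma ca_number_le_prod:
  assumes "finite B" "\<And>q. q \<in> B \<Longrightarrow> prime q"
    and "{q. prime q \<and> ca_exponent e q \<noteq> 0} \<subseteq> B" "\<And>q. q \<in> B \<Longrightarrow> ca_exponent e q \<le> b q"
  shows "ca_number e \<le> (\<Prod>q\<in>B. q ^ b q)"
proof -
  have "ca_number e = (\<Prod>q\<in>B. q ^ ca_exponent e q)"
    using assms by (intro ca_number_eq_prod) auto
  also have "\<dots> \<le> (\<Prod>q\<in>B. q ^ b q)"
    using assms by (intro prod_mono conjI) (auto intro!: power_increasing simp: prime_gt_0_nat Suc_le_eq)
  finally show ?thesis .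
qed

section \<open>The enumeration of E\<close>

text \<open>Makes \<open>eps\<close> well defined. Existence is by induction: infinity of
  \<open>S\<close> gives some \<open>z\<close> below the current \<open>x\<close>, and the finitely
  many elements from \<open>z\<close> up to \<open>x\<close> have a maximum, the next element.
  Uniqueness holds because the count strictly drops as \<open>x\<close> grows.\<close>

lemma ex1_card_upper_part:
  fixes S :: "real set"
  assumes "infinite S" "\<And>x. x \<in> S \<Longrightarrow> finite {y \<in> S. x \<le> y}" "1 \<le> i"
  shows "\<exists>!x. x \<in> S \<and> card {y \<in> S. x \<le> y} = i"
proof -
  have "\<exists>x\<in>S. card {y \<in> S. x \<le> y} = i"
    using assms(3)
  proof (induction i rule: nat_induct_at_least)
    case base
    obtain x where x: "x \<in> S" using assms(1) by fastforce
    define m where "m = Max {y \<in> S. x \<le> y}"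
    have m: "m \<in> {y \<in> S. x \<le> y}"
      unfolding m_def using assms(2)[OF x] x by (intro Max_in) auto
    have "y \<le> m" if "y \<in> S" "x \<le> y" for y
      unfolding m_def using assms(2)[OF x] that by (intro Max_ge) auto
    then have "{y \<in> S. m \<le> y} = {m}" using m by force
    then show ?case using m by (intro bexI[of _ m]) auto
  next
    case (Suc n)
    then obtain x where x: "x \<in> S" "card {y \<in> S. x \<le> y} = n" by blast
    have "infinite (S - {y \<in> S. x \<le> y})"
      using assms(1,2) x(1) by simp
    then obtain z where "z \<in> S - {y \<in> S. x \<le> y}"
      using infinite_imp_nonempty by blast
    then have z: "z \<in> S" "z < x" by auto
    define m where "m = Max {y \<in> S. z \<le> y \<and> y < x}"
    have fin: "finite {y \<in> S. z \<le> y \<and> y < x}"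
      by (rule finite_subset[OF _ assms(2)[OF z(1)]]) auto
    have m: "m \<in> {y \<in> S. z \<le> y \<and> y < x}"
      unfolding m_def using fin z by (intro Max_in) auto
    have "y \<le> m" if "y \<in> S" "z \<le> y" "y < x" for y
      unfolding m_def using fin that by (intro Max_ge) auto
    then have "{y \<in> S. m \<le> y} = insert m {y \<in> S. x \<le> y}" using m by force
    moreover have "m \<notin> {y \<in> S. x \<le> y}" using m by auto
    ultimately have "card {y \<in> S. m \<le> y} = Suc n"
      using x assms(2) by simp
    with m show ?case by auto
  qed
  moreover have "card {w \<in> S. y \<le> w} < card {w \<in> S. x \<le> w}" if "x \<in> S" "y \<in> S" "x < y" for x y
  proof (rule psubset_card_mono)
    show "finite {w \<in> S. x \<le> w}" using that(1) by (rule assms(2))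
    show "{w \<in> S. y \<le> w} \<subset> {w \<in> S. x \<le> w}" using that by force
  qed
  ultimately show ?thesis
    by (metis less_irrefl linorder_neqE_linordered_idom)
qed

text \<open>The values at level 1 alone are distinct for distinct primes.\<close>

lemma infinite_E: "infinite E"
proof -
  have "(\<lambda>p. F (real p) 1) ` {p. prime p} \<subseteq> E" unfolding E_def by auto
  moreover have "inj_on (\<lambda>p. F (real p) 1) {p. prime p}"
  proof (rule inj_onI, clarsimp)
    fix p q :: nat assume "prime p" "prime q" "F p (Suc 0) = F q (Suc 0)"
    then show "p = q"
      using F_strict_antimono_left[of p q 1] F_strict_antimono_left[of q p 1]
        prime_gt_1_nat[of p] prime_gt_1_nat[of q]
      by (cases p q rule: linorder_cases) auto
  qed
  ultimately show ?thesis
    using primes_infinite finite_imageD finite_subset by blast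
qed

lemma E_pos: "e \<in> E \<Longrightarrow> 0 < e"
  unfolding E_def using F_pos prime_gt_1_nat by fastforce

text \<open>\<open>e <= F p k < 2 / (k * p)\<close> bounds the product \<open>k * p\<close>, hence
  both factors.\<close>

lemma finite_upper_part_E:
  assumes "0 < e"
  shows "finite {e' \<in> E. e \<le> e'}"
proof (rule finite_subset)
  let ?N = "nat \<lceil>2 / e\<rceil>"
  show "{e' \<in> E. e \<le> e'} \<subseteq> (\<lambda>(p, k). F (real p) k) ` ({..?N} \<times> {..?N})"
  proof
    fix e' assume "e' \<in> {e' \<in> E. e \<le> e'}"
    then obtain p k where pk: "prime p" "1 \<le> k" "e' = F (real p) k" "e \<le> F p k"
      unfolding E_def by auto
    have "2 \<le> p" using pk by (simp add: prime_ge_2_nat)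
    have "e < 2 / (k * p)"
      using F_less_inverse[of p k] \<open>2 \<le> p\<close> pk by simp
    then have "real (k * p) < 2 / e"
      using assms pk \<open>2 \<le> p\<close> by (simp add: field_simps)
    then have "k * p \<le> ?N" by linarith
    moreover have "k \<le> k * p" "p \<le> k * p" using pk \<open>2 \<le> p\<close> by auto
    ultimately have "k \<le> ?N" "p \<le> ?N" by linarith+
    with pk show "e' \<in> (\<lambda>(p, k). F (real p) k) ` ({..?N} \<times> {..?N})" by auto
  qed
qed simp

lemma eps_in_E:
  assumes "1 \<le> i"
  shows "eps i \<in> E"
proof -
  have "\<exists>!e. e \<in> E \<and> card {e' \<in> E. e \<le> e'} = i"
    using infinite_E finite_upper_part_E E_pos assms by (intro ex1_card_upper_part) auto
  from theI'[OF this] show ?thesis unfolding eps_def by blast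
qed

section \<open>Small primes\<close>

text \<open>Certifies logarithm bounds by integer powers: (1 + 1/8)^8 exceeds 2.56 and is at most
  the base of the natural logarithm.\<close>

lemma ln_real_less:
  fixes n m :: nat
  assumes "0 < n" "n \<le> N" "real N < 2.56 ^ m"
  shows "ln (real n) < real m"
proof -
  have "(9 / 8 :: real) \<le> exp (1 / 8)"
    using exp_ge_add_one_self[of "1 / 8"] by simp
  then have "(9 / 8 :: real) ^ 8 \<le> exp (1 / 8) ^ 8" by (intro power_mono) auto
  also have "exp (1 / 8 :: real) ^ 8 = exp 1" by (simp flip: exp_of_nat_mult)
  finally have "(2.56 :: real) \<le> exp 1" by (simp add: eval_nat_numeral)
  then have "(2.56 :: real) ^ m \<le> exp 1 ^ m" by (intro power_mono) auto
  also have "\<dots> = exp (real m)" by (simp flip: exp_of_nat_mult)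
  finally have "real n < exp (real m)" using assms by linarith
  then show ?thesis using assms(1) by (metis exp_less_cancel_iff exp_ln of_nat_0_less_iff)
qed

lemma primes_less_17:
  assumes "prime (q::nat)" "q < 17"
  shows "q \<in> {2, 3, 5, 7, 11, 13}"
proof -
  have "q \<in> {0..<17}" using assms(2) by simp
  moreover have "\<not> prime (4::nat)" "\<not> prime (6::nat)" "\<not> prime (8::nat)" "\<not> prime (9::nat)" "\<not> prime (10::nat)"
    "\<not> prime (12::nat)" "\<not> prime (14::nat)" "\<not> prime (15::nat)" "\<not> prime (16::nat)"
    by simp_all
  ultimately show ?thesis
    using assms(1) by (auto simp: numeral_eq_Suc less_Suc_eq)
qed

text \<open>Excludes \<open>p <= 13\<close> for CA3 numbers. With \<open>p\<close> the next prime,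
  the rational test caps each exponent, and the resulting products 1, 4, 24, 360, 5040, 166320 stay
  below \<open>2.56 ^ p\<close>.\<close>

lemma ln_ca_number_less_prime:
  assumes "0 < e" "F p 1 < e" "prime p" "p < 17"
    and supp: "\<And>q. prime q \<Longrightarrow> ca_exponent e q \<noteq> 0 \<Longrightarrow> q < p"
  shows "ln (real (ca_number e)) < real p"
proof -
  note exps = ca_exponent_leI[OF assms(1-3)]
  have supp': "{q. prime q \<and> ca_exponent e q \<noteq> 0} \<subseteq> B"
    if "\<And>q. q \<in> {2, 3, 5, 7, 11, 13} \<Longrightarrow> q < p \<Longrightarrow> q \<in> B" for B
    using that supp primes_less_17 assms(4) by (smt (verit) less_trans mem_Collect_eq subsetI)
  have sums: "(\<Sum>i = 1..Suc 1. x ^ i) = x + x ^ 2"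
    "(\<Sum>i = 1..Suc 2. x ^ i) = x + x ^ 2 + x ^ 3"
    "(\<Sum>i = 1..Suc 3. x ^ i) = x + x ^ 2 + x ^ 3 + x ^ 4"
    "(\<Sum>i = 1..Suc 4. x ^ i) = x + x ^ 2 + x ^ 3 + x ^ 4 + x ^ 5" for x :: real
    by (simp_all add: eval_nat_numeral)
  note le_prod = ca_number_le_prod[where e = e]
  consider "p = 2" | "p = 3" | "p = 5" | "p = 7" | "p = 11" | "p = 13"
    using primes_less_17[OF assms(3,4)] by auto
  then show ?thesis
  proof cases
    case 1
    \<comment> \<open>No prime lies below 2, so the bound is the empty product 1.\<close>
    have "ca_number e \<le> (\<Prod>q\<in>{}. q ^ 0)"
      by (intro le_prod supp') (use 1 in auto)
    then show ?thesis
      using 1 ca_number_pos[of e] by (intro ln_real_less[of _ 1]) (auto simp: power_divide)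
  next
    case 2
    have "ca_exponent e 2 \<le> 2"
      \<comment> \<open>In all cases \<open>m\<close> is the least integer with
        \<open>p <= q ^ m\<close>.\<close>
      by (rule exps[where m = 2]; (simp only: sums 2)?; simp add: power_divide)
    then have "ca_number e \<le> (\<Prod>q\<in>{2}. q ^ 2)"
      by (intro le_prod supp') (use 2 in auto)
    then show ?thesis
      using 2 ca_number_pos[of e] by (intro ln_real_less[of _ 4]) (auto simp: power_divide)
  next
    case 3
    have "ca_exponent e 2 \<le> 3"
      by (rule exps[where m = 3]; (simp only: sums 3)?; simp add: power_divide)
    moreover have "ca_exponent e 3 \<le> 1"
      by (rule exps[where m = 2]; (simp only: sums 3)?; simp add: power_divide)
    ultimately have "ca_number e \<le> (\<Prod>q\<in>{2, 3}. q ^ (if q = 2 then 3 else 1))"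
      by (intro le_prod supp') (use 3 in auto)
    then show ?thesis
      using 3 ca_number_pos[of e] by (intro ln_real_less[of _ 24]) (auto simp: power_divide)
  next
    case 4
    have "ca_exponent e 2 \<le> 3"
      by (rule exps[where m = 3]; (simp only: sums 4)?; simp add: power_divide)
    moreover have "ca_exponent e 3 \<le> 2"
      by (rule exps[where m = 2]; (simp only: sums 4)?; simp add: power_divide)
    moreover have "ca_exponent e 5 \<le> 1"
      by (rule exps[where m = 2]; (simp only: sums 4)?; simp add: power_divide)
    ultimately have "ca_number e \<le> (\<Prod>q\<in>{2, 3, 5}. q ^ (if q = 2 then 3 else if q = 3 then 2 else 1))"
      by (intro le_prod supp') (use 4 in auto)
    then show ?thesis
      using 4 ca_number_pos[of e] by (intro ln_real_less[of _ 360]) (auto simp: power_divide)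
  next
    case 5
    have "ca_exponent e 2 \<le> 4"
      by (rule exps[where m = 4]; (simp only: sums 5)?; simp add: power_divide)
    moreover have "ca_exponent e 3 \<le> 2"
      by (rule exps[where m = 3]; (simp only: sums 5)?; simp add: power_divide)
    moreover have "ca_exponent e 5 \<le> 1"
      by (rule exps[where m = 2]; (simp only: sums 5)?; simp add: power_divide)
    moreover have "ca_exponent e 7 \<le> 1"
      by (rule exps[where m = 2]; (simp only: sums 5)?; simp add: power_divide)
    ultimately have "ca_number e \<le> (\<Prod>q\<in>{2, 3, 5, 7}. q ^ (if q = 2 then 4 else if q = 3 then 2 else 1))"
      by (intro le_prod supp') (use 5 in auto)
    then show ?thesis
      using 5 ca_number_pos[of e] by (intro ln_real_less[of _ 5040]) (auto simp: power_divide)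
  next
    case 6
    have "ca_exponent e 2 \<le> 4"
      by (rule exps[where m = 4]; (simp only: sums 6)?; simp add: power_divide)
    \<comment> \<open>The test fails for \<open>k = 2\<close>, as (40/39)^3 > 14/13; the weaker cap
      3 still suffices.\<close>
    moreover have "ca_exponent e 3 \<le> 3"
      by (rule exps[where m = 3]; (simp only: sums 6)?; simp add: power_divide)
    moreover have "ca_exponent e 5 \<le> 1"
      by (rule exps[where m = 2]; (simp only: sums 6)?; simp add: power_divide)
    moreover have "ca_exponent e 7 \<le> 1"
      by (rule exps[where m = 2]; (simp only: sums 6)?; simp add: power_divide)
    moreover have "ca_exponent e 11 \<le> 1"
      by (rule exps[where m = 2]; (simp only: sums 6)?; simp add: power_divide)
    ultimately have "ca_number e \<le> (\<Prod>q\<in>{2, 3, 5, 7, 11}. q ^ (if q = 2 then 4 else if q = 3 then 3 else 1))"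
      by (intro le_prod supp') (use 6 in auto)
    then show ?thesis
      using 6 ca_number_pos[of e] by (intro ln_real_less[of _ 166320]) (auto simp: power_divide)
  qed
qed

section \<open>The growth of G\<close>

theorem theorem2:
  fixes i j p :: nat and t0 :: real
  assumes "1 \<le> i" and "CA3 (CA i)"
    and "p = next_prime (P (CA i))"
    and "1 \<le> j" and "eps j = F (real p) 1"
    and "t0 = min_point (eps j)"
  shows "G (CA j) > G (CA i) * (1 + 3.2961 / ((ln t0)\<^sup>2 * ln (ln t0)))"
proof -
  define n where "n = CA i"
  define e where "e = F (real p) 1"
  have "eps i \<in> E" using assms(1) by (rule eps_in_E)
  then have "0 < eps i" by (rule E_pos)
  have n: "n = ca_number (eps i)" unfolding n_def CA_def ..
  have m: "CA j = ca_number e" unfolding CA_def assms(5) e_def ..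
  have "\<exists>p. prime p \<and> P n < p" using bigger_prime by blast
  from LeastI_ex[OF this] have p: "prime p" "P n < p"
    unfolding assms(3) next_prime_def n_def by auto
  then have "1 < real p" using prime_gt_1_nat by simp
  have "p < ln n" using assms(2) unfolding CA3_def n_def assms(3) by simp
  have supp: "q < p" if "prime q" "ca_exponent (eps i) q \<noteq> 0" for q
  proof -
    have "q \<le> P n"
      unfolding P_def n prime_factors_ca_number[OF \<open>0 < eps i\<close>]
      using that finite_ca_support[OF \<open>0 < eps i\<close>] by (intro Max_ge) auto
    with p show ?thesis by simp
  qed
  then have "ca_exponent (eps i) p = 0" using p by blast
  \<comment> \<open>Exponent zero says that \<open>p\<close> lies beyond the first threshold of
    \<open>eps i\<close>, that is \<open>F p 1 < eps i\<close>.\<close>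
  then have less: "e < eps i"
    using le_ca_exponent_iff[OF \<open>0 < eps i\<close> p(1), of 1] unfolding e_def by simp
  have "17 \<le> p"
    using ln_ca_number_less_prime[OF \<open>0 < eps i\<close> _ p(1) _ supp] less \<open>p < ln n\<close>
    unfolding n e_def by force
  then have p17: "17 \<le> real p" by simp
  have "0 < e" unfolding e_def using \<open>1 < real p\<close> by (intro F_pos) auto
  \<comment> \<open>As \<open>e = F p 1\<close>, the prime \<open>p\<close> sits exactly on the
    first threshold of \<open>e\<close>, which counts as inside.\<close>
  have "1 \<le> ca_exponent e p"
    using le_ca_exponent_iff[OF \<open>0 < e\<close> p(1), of 1] unfolding e_def by simp
  then have "p * n \<le> ca_number e"
    unfolding n using \<open>0 < e\<close> less p(1) \<open>ca_exponent (eps i) p = 0\<close>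
    by (intro mult_ca_number_le) auto

  define c where "c = ln (real p)"
  define L where "L = ln (real n)"
  define M where "M = ln (real (ca_number e))"
  have "0 < n" "0 < ca_number e" unfolding n by (simp_all add: ca_number_pos)
  have "p < L" using \<open>p < ln n\<close> unfolding L_def .
  have "1 < c" unfolding c_def using ln_17_bounds(1) ln_mono[OF p17] by simp
  have "L + c \<le> M"
  proof -
    have "L + c = ln (real (p * n))"
      unfolding L_def c_def using \<open>0 < n\<close> \<open>1 < real p\<close> by (simp add: ln_mult)
    also have "\<dots> \<le> M"
      unfolding M_def using \<open>p * n \<le> ca_number e\<close> \<open>0 < n\<close> \<open>1 < real p\<close> by (intro ln_mono) (simp_all flip: of_nat_mult)
    finally show ?thesis .
  qed
  have e_eq: "e = ln (1 + 1 / p) / c" unfolding e_def F_def c_def by simp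

  have "0 < 1 / e" using \<open>0 < e\<close> by simp
  then obtain x where x: "1 < x" "x * ln x = 1 / e" using ex_mult_ln_eq by blast
  then have t0: "ln t0 = x" unfolding assms(5,6) e_def using min_point_eq by simp
  \<comment> \<open>Otherwise \<open>x * ln x <= p * ln p\<close>, whereas
    \<open>ln (1 + 1 / p) < 1 / p\<close> makes \<open>1 / e\<close> exceed
    \<open>p * ln p\<close>.\<close>
  have "p < x"
  proof (rule ccontr)
    assume "\<not> p < x"
    then have "x * ln x \<le> p * ln p" using x(1) by (intro mult_mono) auto
    moreover have "ln (1 + 1 / p) < 1 / p"
      using ln_eq_minus_one[of "1 + 1 / p"] ln_le_minus_one[of "1 + 1 / p"] \<open>1 < real p\<close>
      by (fastforce simp: add_pos_pos)
    then have "e < 1 / (p * c)"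
      unfolding e_eq using \<open>1 < c\<close> divide_strict_right_mono[of "ln (1 + 1 / p)" "1 / p" c] by simp
    then have "p * c < 1 / e"
      using \<open>0 < e\<close> \<open>1 < c\<close> \<open>1 < real p\<close> by (simp add: field_simps)
    ultimately show False using x(2) unfolding c_def by simp
  qed
  then have "ln p < ln x" using \<open>1 < real p\<close> by simp

  text \<open>\<open>s \<mapsto> e * s - ln (ln s)\<close> increases beyond \<open>L + c\<close>, since \<open>1 / e \<le> (p + 1) * ln p\<close>.\<close>
  have tangent: "ln (ln M) - ln (ln (L + c)) \<le> e * (M - (L + c))"
  proof (cases "M = L + c")
    case False
    have "1 < L + c" "1 < M" using \<open>p < L\<close> \<open>1 < c\<close> \<open>L + c \<le> M\<close> \<open>1 < real p\<close> by linarith+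
    have "1 / (p + 1) \<le> ln (1 + 1 / p)"
      using ln_le_minus_one[of "p / (p + 1)"] ln_inverse[of "1 + 1 / p"] \<open>1 < real p\<close>
      by (simp add: field_simps)
    then have "1 / (p + 1) / c \<le> e"
      unfolding e_eq using \<open>1 < c\<close> by (intro divide_right_mono) auto
    \<comment> \<open>\<open>L > p\<close> and \<open>c > 1\<close> give
      \<open>L + c >= p + 1\<close>, which handles both factors.\<close>
    moreover have "(p + 1) * c \<le> (L + c) * ln (L + c)"
      unfolding c_def using \<open>p < L\<close> \<open>1 < c\<close> \<open>1 < real p\<close>
      by (intro mult_mono ln_mono) (auto simp: c_def)
    then have "1 / ((L + c) * ln (L + c)) \<le> 1 / ((p + 1) * c)"
      using \<open>1 < c\<close> \<open>1 < real p\<close> by (intro frac_le) auto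
    ultimately have "1 / ((L + c) * ln (L + c)) \<le> e" by simp
    then have "(M - (L + c)) * (1 / ((L + c) * ln (L + c))) \<le> (M - (L + c)) * e"
      using \<open>L + c \<le> M\<close> by (intro mult_left_mono) auto
    then show ?thesis
      using ln_ln_less_tangent[OF \<open>1 < L + c\<close> \<open>1 < M\<close>] False by (simp add: mult.commute)
  qed simp

  have "1 < L" "1 < M" "0 < ln L" "0 < ln M" "0 < ln (L + c)"
    using \<open>p < L\<close> \<open>1 < c\<close> \<open>L + c \<le> M\<close> \<open>1 < real p\<close> by simp_all
  have G: "G n = rho n / ln L" "G (CA j) = rho (ca_number e) / ln M"
    unfolding G_def m L_def M_def by simp_all
  have "0 < rho n" using \<open>0 < n\<close> by (rule rho_pos)
  have pw: "real n powr e = exp (e * L)" "real (ca_number e) powr e = exp (e * M)"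
    unfolding L_def M_def powr_def using \<open>0 < n\<close> \<open>0 < ca_number e\<close> by auto
  have "rho n * exp (e * (M - L)) \<le> rho (ca_number e)"
    using rho_ca_number_mono[OF \<open>0 < e\<close>, of "eps i"] less
    unfolding n[symmetric] pw by (simp add: field_simps right_diff_distrib exp_diff)
  then have rho_ge: "G n * (exp (e * (M - L)) * ln L) \<le> rho (ca_number e)"
    unfolding G using \<open>0 < ln L\<close> by simp
  have lnM: "ln M \<le> ln (L + c) * exp (e * (M - (L + c)))"
  proof -
    have "ln M = ln (L + c) * exp (ln (ln M) - ln (ln (L + c)))"
      using \<open>0 < ln M\<close> \<open>0 < ln (L + c)\<close> by (simp add: exp_diff)
    also have "\<dots> \<le> ln (L + c) * exp (e * (M - (L + c)))"
      using tangent \<open>0 < ln (L + c)\<close> by (intro mult_left_mono) auto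
    finally show ?thesis .
  qed
  \<comment> \<open>The stretch from \<open>L\<close> to \<open>L + c\<close> contributes exactly
    \<open>e * c = ln (1 + 1 / p)\<close>.\<close>
  have expM: "exp (e * (M - L)) = (1 + 1 / p) * exp (e * (M - (L + c)))"
  proof -
    have "e * (M - L) = ln (1 + 1 / p) + e * (M - (L + c))"
      using e_eq \<open>1 < c\<close> by (simp add: field_simps)
    then show ?thesis using \<open>1 < real p\<close> by (simp add: exp_add add_pos_pos)
  qed
  \<comment> \<open>\<open>p < x\<close> allows \<open>p\<close> in place of \<open>x\<close> in the
    error term, and \<open>p < L\<close> allows \<open>p\<close> in place of \<open>L\<close> in the
    ratio of logarithms.\<close>
  have ratio: "(1 + 3.2961 / (x\<^sup>2 * ln x)) * ln (L + c) < (1 + 1 / p) * ln L"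
  proof -
    have "p\<^sup>2 * ln p \<le> x\<^sup>2 * ln x"
      using \<open>p < x\<close> \<open>ln p < ln x\<close> \<open>1 < real p\<close> by (intro mult_mono power_mono) auto
    then have "3.2961 / (x\<^sup>2 * ln x) \<le> 3.2961 / (p\<^sup>2 * ln p)"
      using \<open>1 < real p\<close> by (intro frac_le) auto
    moreover have "ln (L + c) / ln L \<le> ln (p + c) / ln p"
      using \<open>p < L\<close> \<open>1 < real p\<close> \<open>1 < c\<close> by (intro ln_shift_ratio_antimono) auto
    ultimately have "(1 + 3.2961 / (x\<^sup>2 * ln x)) * (ln (L + c) / ln L)
        \<le> (1 + 3.2961 / (p\<^sup>2 * ln p)) * (ln (p + c) / ln p)"
      using \<open>0 < ln (L + c)\<close> \<open>0 < ln L\<close> \<open>1 < real p\<close> by (intro mult_mono) (auto intro!: add_nonneg_nonneg)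
    also have "\<dots> < 1 + 1 / p"
      using ln_shift_ratio_bound[OF p17] by (simp add: c_def)
    finally show ?thesis using \<open>0 < ln L\<close> by (simp add: field_simps)
  qed
  have "0 < G n" unfolding G using \<open>0 < rho n\<close> \<open>0 < ln L\<close> by simp
  define K where "K = 1 + 3.2961 / (x\<^sup>2 * ln x)"
  have "0 \<le> K" unfolding K_def using x(1) by simp
  \<comment> \<open>The factor \<open>exp (e * (M - (L + c)))\<close> occurs in the bound for
    \<open>ln M\<close> and in the gain of \<open>rho\<close>, so the excess of \<open>M\<close>
    over \<open>L + c\<close> cancels and \<open>ratio\<close> decides.\<close>
  have "G n * K * ln M \<le> G n * K * (ln (L + c) * exp (e * (M - (L + c))))"
    using lnM \<open>0 < G n\<close> \<open>0 \<le> K\<close> by (intro mult_left_mono) auto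
  also have "\<dots> = G n * exp (e * (M - (L + c))) * (K * ln (L + c))" by simp
  also have "\<dots> < G n * exp (e * (M - (L + c))) * ((1 + 1 / p) * ln L)"
    using ratio \<open>0 < G n\<close> unfolding K_def by (intro mult_strict_left_mono) auto
  also have "\<dots> = G n * (exp (e * (M - L)) * ln L)"
    unfolding expM by simp
  also have "\<dots> \<le> rho (ca_number e)" by (rule rho_ge)
  finally have "G n * K < G (CA j)"
    unfolding G using \<open>0 < ln M\<close> by (simp add: field_simps)
  then show ?thesis unfolding n_def K_def t0 .
qed

end
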